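(* Let $L\in\mathbb{N}$ be such that $\sqrt{L\log L}\geq 55$. Then for all integers $g\geq L$, $$f(g)=|S(g)|> e^{\frac{1}{4}\sqrt{\frac{g}{\log g}}}.$$
   Context: For a positive integer $g$, $\mathrm{Sp}(2g,\mathbb{Z})$ denotes the group of all $2g\times 2g$ integer matrices $A$ satisfying $A^{\top}JA=J$, where $J=\begin{pmatrix}0_g & I_g\\ -I_g & 0_g\end{pmatrix}$. The set $S(g)=\{m\in\mathbb{N}\mid \exists\, A\in \mathrm{Sp}(2g,\mathbb{Z}),\ A\neq 1,\ o(A)=m\}$ is the set of positive integers occurring as the (finite) order $o(A)$ of a non-identity element $A$; it is a finite set, and $f(g)=|S(g)|$ is its cardinality. $\log$ is the natural logarithm. *)

theory Defs
  imports Complex_Main "HOL-Algebra.Multiplicative_Group" "Jordan_Normal_Form.Determinant"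
begin

definition symp_J :: "nat \<Rightarrow> int mat" where
  "symp_J g = four_block_mat (0\<^sub>m g g) (1\<^sub>m g) (- 1\<^sub>m g) (0\<^sub>m g g)"

definition Sp :: "nat \<Rightarrow> int mat monoid" where
  "Sp g = \<lparr>carrier = {A \<in> carrier_mat (2 * g) (2 * g). transpose_mat A * symp_J g * A = symp_J g},
           monoid.mult = (*), one = 1\<^sub>m (2 * g)\<rparr>"

(* group.ord assigns 0 to elements of infinite order, hence the condition m > 0. *)
definition Sp_orders :: "nat \<Rightarrow> nat set" where
  "Sp_orders g = {m. m > 0 \<and>
     (\<exists>A \<in> carrier (Sp g). A \<noteq> \<one>\<^bsub>Sp g\<^esub> \<and> group.ord (Sp g) A = m)}"

definition num_Sp_orders :: "nat \<Rightarrow> nat" where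
  "num_Sp_orders g = card (Sp_orders g)"

lemma symp_J_carrier [simp]: "symp_J g \<in> carrier_mat (2 * g) (2 * g)"
  unfolding symp_J_def mult_2 by (intro four_block_carrier_mat zero_carrier_mat)

lemma symp_J_square: "symp_J g * symp_J g = - 1\<^sub>m (2 * g)"
proof -
  have "symp_J g * symp_J g
      = four_block_mat (- 1\<^sub>m g) (0\<^sub>m g g) (0\<^sub>m g g) (- 1\<^sub>m g)"
    unfolding symp_J_def
    by (subst mult_four_block_mat[where ?nr1.0 = g and ?n1.0 = g and ?n2.0 = g and ?nr2.0 = g
          and ?nc1.0 = g and ?nc2.0 = g]) auto
  also have "\<dots> = - 1\<^sub>m (2 * g)"
    by (rule eq_matI) auto
  finally show ?thesis .
qed

lemma int_mat_left_right_inverse: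
  fixes A B :: "int mat"
  assumes A: "A \<in> carrier_mat n n" and B: "B \<in> carrier_mat n n" and AB: "A * B = 1\<^sub>m n"
  shows "B * A = 1\<^sub>m n"
proof -
  let ?h = "map_mat rat_of_int"
  have h1: "?h (1\<^sub>m n) = 1\<^sub>m n"
    by (rule of_int_hom.mat_hom_one)
  have "?h A * ?h B = 1\<^sub>m n"
    by (simp only: of_int_hom.mat_hom_mult[OF A B, symmetric] AB h1)
  then have "?h B * ?h A = 1\<^sub>m n"
    by (rule mat_mult_left_right_inverse[rotated 2]) (use A B in \<open>simp_all only: map_carrier_mat\<close>)
  then have "?h (B * A) = ?h (1\<^sub>m n)"
    by (simp only: of_int_hom.mat_hom_mult[OF B A] h1)
  then show ?thesis
    by (rule of_int_hom.mat_hom_inj)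
qed

lemma transpose_congruence_mult:
  fixes A B J :: "'a :: comm_semiring_1 mat"
  assumes A: "A \<in> carrier_mat n n" and B: "B \<in> carrier_mat n n" and J: "J \<in> carrier_mat n n"
  shows "transpose_mat (A * B) * J * (A * B) = transpose_mat B * (transpose_mat A * J * A) * B"
proof -
  have AT: "transpose_mat A \<in> carrier_mat n n" and BT: "transpose_mat B \<in> carrier_mat n n"
    using A B by simp_all
  note ATJ = mult_carrier_mat[OF AT J]
  have "transpose_mat (A * B) * J * (A * B) = transpose_mat B * transpose_mat A * J * (A * B)"
    by (simp only: transpose_mult[OF A B])
  also have "\<dots> = transpose_mat B * (transpose_mat A * J) * (A * B)"
    by (simp only: assoc_mult_mat[OF BT AT J])
  also have "\<dots> = transpose_mat B * (transpose_mat A * J) * A * B"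
    by (simp only: assoc_mult_mat[OF mult_carrier_mat[OF BT ATJ] A B])
  also have "\<dots> = transpose_mat B * (transpose_mat A * J * A) * B"
    by (simp only: assoc_mult_mat[OF BT ATJ A])
  finally show ?thesis .
qed

lemma carrier_Sp_iff:
  "A \<in> carrier (Sp g) \<longleftrightarrow>
     A \<in> carrier_mat (2 * g) (2 * g) \<and> transpose_mat A * symp_J g * A = symp_J g"
  by (simp only: Sp_def partial_object.simps mem_Collect_eq)

lemma mult_Sp: "A \<otimes>\<^bsub>Sp g\<^esub> B = A * B"
  by (simp only: Sp_def monoid.simps)

lemma one_Sp: "\<one>\<^bsub>Sp g\<^esub> = 1\<^sub>m (2 * g)"
  by (simp only: Sp_def monoid.simps)

lemma group_Sp: "group (Sp g)"
proof (rule groupI)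
  let ?n = "2 * g" and ?J = "symp_J g"
  note J = symp_J_carrier[of g]
  show "x \<otimes>\<^bsub>Sp g\<^esub> y \<in> carrier (Sp g)"
    if "x \<in> carrier (Sp g)" "y \<in> carrier (Sp g)" for x y
  proof -
    have x: "x \<in> carrier_mat ?n ?n" and y: "y \<in> carrier_mat ?n ?n"
      and xJ: "transpose_mat x * ?J * x = ?J" and yJ: "transpose_mat y * ?J * y = ?J"
      using that unfolding carrier_Sp_iff by blast+
    show ?thesis
      unfolding carrier_Sp_iff mult_Sp
      by (simp only: transpose_congruence_mult[OF x y J] xJ yJ mult_carrier_mat[OF x y])
  qed
  show "\<one>\<^bsub>Sp g\<^esub> \<in> carrier (Sp g)"
    unfolding carrier_Sp_iff one_Sp
    by (simp only: transpose_one left_mult_one_mat[OF J] right_mult_one_mat[OF J] one_carrier_mat)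
  show "x \<otimes>\<^bsub>Sp g\<^esub> y \<otimes>\<^bsub>Sp g\<^esub> z = x \<otimes>\<^bsub>Sp g\<^esub> (y \<otimes>\<^bsub>Sp g\<^esub> z)"
    if "x \<in> carrier (Sp g)" "y \<in> carrier (Sp g)" "z \<in> carrier (Sp g)" for x y z
    using that unfolding carrier_Sp_iff mult_Sp by (blast intro: assoc_mult_mat)
  show "\<one>\<^bsub>Sp g\<^esub> \<otimes>\<^bsub>Sp g\<^esub> x = x" if "x \<in> carrier (Sp g)" for x
    using that unfolding carrier_Sp_iff mult_Sp one_Sp by (blast intro: left_mult_one_mat)
  show "\<exists>y \<in> carrier (Sp g). y \<otimes>\<^bsub>Sp g\<^esub> x = \<one>\<^bsub>Sp g\<^esub>" if "x \<in> carrier (Sp g)" for x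
  proof -
    have x: "x \<in> carrier_mat ?n ?n" and xJ: "transpose_mat x * ?J * x = ?J"
      using that unfolding carrier_Sp_iff by blast+
    have xT: "transpose_mat x \<in> carrier_mat ?n ?n" using x by simp
    note xTJ = mult_carrier_mat[OF xT J]
    note JxTJ = mult_carrier_mat[OF J xTJ]
    define y where "y = - (?J * (transpose_mat x * ?J))"
    have y: "y \<in> carrier_mat ?n ?n"
      unfolding y_def using JxTJ by (rule uminus_carrier_mat)
    have "y * x = - (?J * (transpose_mat x * ?J) * x)"
      unfolding y_def by (rule uminus_mult_left_mat) (use carrier_matD[OF JxTJ] carrier_matD[OF x] in argo)
    also have "?J * (transpose_mat x * ?J) * x = ?J * ?J"
      by (simp only: assoc_mult_mat[OF J xTJ x] xJ)
    also have "- \<dots> = 1\<^sub>m ?n"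
      by (simp only: symp_J_square uminus_uminus_mat)
    finally have yx: "y * x = 1\<^sub>m ?n" .
    have xy: "x * y = 1\<^sub>m ?n"
      by (rule int_mat_left_right_inverse[OF y x yx])
    have "transpose_mat y * ?J * y = transpose_mat y * (transpose_mat x * ?J * x) * y"
      by (simp only: xJ)
    also have "\<dots> = transpose_mat (x * y) * ?J * (x * y)"
      by (rule transpose_congruence_mult[OF x y J, symmetric])
    also have "\<dots> = ?J"
      by (simp only: xy transpose_one left_mult_one_mat[OF J] right_mult_one_mat[OF J])
    finally show ?thesis
      unfolding mult_Sp one_Sp using y yx carrier_Sp_iff by blast
  qed
qed

end

(* If P is a permutation matrix, the block sum of P with itself is symplectic, so every order of a
   permutation of g points is an order in Sp(2g, Z). In particular the product of any k distinct
   primes with sum at most g is one, and different sets of primes give different products.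
   Put s = sqrt (g / log g), k = ceiling (s / 4) and x = floor (g / k). Any k primes up to x will do,
   and a Chebyshev type bound, obtained from the common multiples of 1, ..., x, gives pi(x) >= 3 k.
   Hence there are at least (pi(x) choose k) >= (pi(x) / k)^k >= 3^k > e^k >= e^(s/4) orders.
   Since card is 0 on infinite sets, the set of orders must also be shown to be finite: every
   finite cyclic subgroup of Sp(2g, Z) embeds into the matrices modulo 4. *)
theory Submission
  imports Defs "HOL-Number_Theory.Cong"
begin

section \<open>A lower bound for the number of primes\<close>

(* The Leibniz harmonic triangle: its first column consists of the 1 / (n + 1), and every other entry
   is a difference of two entries of the preceding column. *)
lemma leibniz_triangle_int:
  fixes M :: nat
  assumes "\<And>i. 0 < i \<Longrightarrow> i \<le> N \<Longrightarrow> i dvd M" "n < N" "k \<le> n"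
  shows "real M / (real (Suc n) * real (n choose k)) \<in> \<int>"
  using assms(2,3)
proof (induction k arbitrary: n)
  case 0
  then obtain c where "M = Suc n * c"
    using assms(1)[of "Suc n"] by auto
  then have "real M / (real (Suc n) * real (n choose 0)) = real c"
    by (simp only: of_nat_mult) simp
  then show ?case by simp
next
  case (Suc k)
  then obtain m where n: "n = Suc m" and km: "k \<le> m" by (cases n) auto
  define a b c where "a = real (m choose k)" and "b = real (n choose k)" and "c = real (n choose Suc k)"
  have pos: "a > 0" "b > 0" "c > 0"
    using km Suc.prems(2) unfolding a_def b_def c_def by (auto simp del: binomial_Suc_Suc)
  have cE: "real (Suc k) * c = real n * a"
    unfolding a_def c_def n of_nat_mult[symmetric] of_nat_eq_iff
    using Suc_times_binomial_eq[of m k] by (simp only: mult.commute)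
  have bE: "real (n - k) * b = real n * a"
    unfolding a_def b_def n of_nat_mult[symmetric] of_nat_eq_iff
    using binomial_absorb_comp[of "Suc m" k] by simp
  have nk: "real (n - k) > 0" "real (Suc k) > 0" "real (n - k) + real (Suc k) = real (Suc n)" "real n > 0"
    using km n by auto
  \<comment> \<open>Over the common denominator \<open>real n * a\<close> the numerators are n - k
    and k + 1, which add up to n + 1. This is the recurrence of the triangle.\<close>
  have "1 / b = real (n - k) / (real n * a)" "1 / c = real (Suc k) / (real n * a)"
    using bE cE pos nk by (simp_all add: field_simps)
  then have "1 / b + 1 / c = real (Suc n) / (real n * a)"
    using nk by (simp flip: add_divide_distrib)
  then have "1 / (real n * a) = (1 / b + 1 / c) / real (Suc n)"
    by (simp del: of_nat_Suc)
  also have "\<dots> = 1 / (real (Suc n) * b) + 1 / (real (Suc n) * c)"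
    by (simp add: add_divide_distrib mult.commute del: of_nat_Suc)
  finally have "1 / (real (Suc n) * c) = 1 / (real n * a) - 1 / (real (Suc n) * b)"
    by simp
  then have "real M / (real (Suc n) * c) = real M / (real n * a) - real M / (real (Suc n) * b)"
    by (metis divide_real_def mult_1 right_diff_distrib)
  moreover have "real M / (real n * a) \<in> \<int>"
    using Suc.IH[of m] Suc.prems km n unfolding a_def by simp
  moreover have "real M / (real (Suc n) * b) \<in> \<int>"
    using Suc.IH[of n] Suc.prems unfolding b_def by simp
  ultimately show ?case unfolding c_def by simp
qed

text \<open>By the integrality in the triangle, each of the N numbers N * (N - 1 choose k) divides M
  and so is at most M. Their sum is N * 2^(N - 1), so averaging gives the bound.\<close>

lemma common_multiple_ge_two_power:
  fixes M :: nat
  assumes "\<And>i. 0 < i \<Longrightarrow> i \<le> N \<Longrightarrow> i dvd M" "M > 0" "N > 0"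
  shows "2 ^ (N - 1) \<le> M"
proof -
  have le: "N * (N - 1 choose k) \<le> M" if "k \<le> N - 1" for k
  proof -
    define d where "d = real N * real (N - 1 choose k)"
    have d: "d > 0" using that assms(3) by (simp add: d_def)
    have "real M / d \<in> \<int>"
      using leibniz_triangle_int[OF assms(1), of N "N - 1" k] that assms(3) by (simp add: d_def)
    moreover have "real M / d > 0" using d assms(2) by simp
    ultimately have "1 \<le> real M / d"
      by (auto elim!: Ints_cases)
    then have "d \<le> real M" using d by simp
    then show ?thesis unfolding d_def by (simp flip: of_nat_mult)
  qed
  have "N * 2 ^ (N - 1) = (\<Sum>k\<le>N - 1. N * (N - 1 choose k))"
    by (simp add: choose_row_sum flip: sum_distrib_left)
  also have "\<dots> \<le> (\<Sum>k\<le>N - 1. M)" by (intro sum_mono le) auto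
  also have "\<dots> = N * M" using assms(3) by simp
  finally show ?thesis using assms(3) by simp
qed

text \<open>The least common multiple M of 1, ..., N is a product with one factor per prime up to N.
  Each factor is a prime power not exceeding N, which bounds M from above. The preceding lemma
  bounds it from below.\<close>

lemma two_power_le_power_prime_count:
  assumes "N > 0"
  shows "2 ^ (N - 1) \<le> N ^ card {p::nat. prime p \<and> p \<le> N}"
proof -
  define P where "P = {p::nat. prime p \<and> p \<le> N}"
  \<comment> \<open>For prime p and N > 0 the maximum is attained: the set contains 0 and is finite
    because k < p^k.\<close>
  define e where "e p = Max {k. p ^ k \<le> N}" for p :: nat
  define M where "M = (\<Prod>p\<in>P. p ^ e p)"
  have finP: "finite P" unfolding P_def by simp
  have fin: "finite {k. p ^ k \<le> N}" if "prime p" for p :: nat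
  proof (rule finite_subset)
    show "{k. p ^ k \<le> N} \<subseteq> {..N}"
    proof safe
      fix k assume "p ^ k \<le> N"
      moreover have "k < p ^ k"
        using power_gt_expt[of p k] prime_gt_1_nat[OF that] by simp
      ultimately show "k \<le> N" by simp
    qed
  qed simp
  have eN: "p ^ e p \<le> N" if "prime p" for p
  proof -
    have "e p \<in> {k. p ^ k \<le> N}" unfolding e_def
      by (rule Max_in[OF fin[OF that]]) (use assms in \<open>auto intro: exI[of _ 0]\<close>)
    then show ?thesis by simp
  qed
  have "i dvd M" if i: "0 < i" "i \<le> N" for i
  proof -
    have "i = (\<Prod>p\<in>prime_factors i. p ^ multiplicity p i)"
      using prime_factorization_nat i by simp
    also have "\<dots> dvd (\<Prod>p\<in>prime_factors i. p ^ e p)"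
    proof (rule prod_dvd_prod)
      fix p assume p: "p \<in> prime_factors i"
      have "p ^ multiplicity p i \<le> i"
        using i by (intro dvd_imp_le multiplicity_dvd) auto
      then have "multiplicity p i \<in> {k. p ^ k \<le> N}" using i by simp
      then have "multiplicity p i \<le> e p" unfolding e_def
        using p by (intro Max_ge fin) auto
      then show "p ^ multiplicity p i dvd p ^ e p" by (rule le_imp_power_dvd)
    qed
    also have "\<dots> dvd M" unfolding M_def
    proof (rule prod_dvd_prod_subset[OF finP])
      show "prime_factors i \<subseteq> P" unfolding P_def using i
        by (auto dest!: dvd_imp_le simp: in_prime_factors_iff)
    qed
    finally show ?thesis .
  qed
  moreover have "M > 0" unfolding M_def P_def
    by (auto intro!: prod_pos simp: prime_gt_0_nat)
  ultimately have "2 ^ (N - 1) \<le> M"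
    using assms by (intro common_multiple_ge_two_power) auto
  also have "M \<le> (\<Prod>p\<in>P. N)" unfolding M_def
    by (intro prod_mono) (auto simp: P_def eN)
  finally show ?thesis by (simp add: P_def)
qed

section \<open>Torsion in the symplectic group\<close>

definition mat_cong :: "nat \<Rightarrow> int \<Rightarrow> int mat \<Rightarrow> int mat \<Rightarrow> bool" where
  "mat_cong n c X Y \<longleftrightarrow> (\<forall>i<n. \<forall>j<n. [X $$ (i, j) = Y $$ (i, j)] (mod c))"

lemma mat_cong_mult:
  assumes "X \<in> carrier_mat n n" "X' \<in> carrier_mat n n" "Y \<in> carrier_mat n n" "Y' \<in> carrier_mat n n"
    and "mat_cong n c X X'" "mat_cong n c Y Y'"
  shows "mat_cong n c (X * Y) (X' * Y')"
  using assms unfolding mat_cong_def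
  by (auto simp: scalar_prod_def intro!: cong_sum cong_mult)

lemma mat_cong_refl: "mat_cong n c X X"
  by (simp add: mat_cong_def)

text \<open>The determinant is an integer polynomial in the entries. This allows a determinant to be
  shown nonzero from its residue alone.\<close>

lemma mat_cong_det:
  assumes "X \<in> carrier_mat n n" "Y \<in> carrier_mat n n" "mat_cong n c X Y"
  shows "[det X = det Y] (mod c)"
  unfolding det_def'[OF assms(1)] det_def'[OF assms(2)]
proof (intro cong_sum cong_mult cong_prod cong_refl)
  fix p i assume "p \<in> {p. p permutes {0..<n}}" and "i \<in> {0..<n}"
  then have "i < n" "p i < n" using permutes_in_image[of p "{0..<n}" i] by auto
  then show "[X $$ (i, p i) = Y $$ (i, p i)] (mod c)"
    using assms(3) by (simp add: mat_cong_def)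
qed

text \<open>Multiplication by the adjugate replaces S by the scalar det S, so the cancellation takes
  place over the integers.\<close>

lemma mat_left_cancel_zero:
  fixes S D :: "int mat"
  assumes S: "S \<in> carrier_mat n n" and D: "D \<in> carrier_mat n n"
    and "S * D = 0\<^sub>m n n" "det S \<noteq> 0"
  shows "D = 0\<^sub>m n n"
proof -
  have "det S \<cdot>\<^sub>m D = adj_mat S * S * D"
    using adj_mat(3)[OF S] mult_smult_assoc_mat[OF one_carrier_mat D, of "det S"] D by simp
  also have "\<dots> = 0\<^sub>m n n"
    using assoc_mult_mat[OF adj_mat(1)[OF S] S D] assms(3) adj_mat(1)[OF S] by simp
  finally have z: "det S \<cdot>\<^sub>m D = 0\<^sub>m n n" .
  show ?thesis
  proof (rule eq_matI)
    fix i j assume ij: "i < dim_row (0\<^sub>m n n :: int mat)" "j < dim_col (0\<^sub>m n n :: int mat)"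
    then have "det S * D $$ (i, j) = 0"
      using arg_cong[OF z, of "\<lambda>A. A $$ (i, j)"] D by simp
    then show "D $$ (i, j) = 0\<^sub>m n n $$ (i, j)" using assms(4) ij by simp
  qed (use D in auto)
qed

text \<open>The witness is S = 1 + B + ... + B^(k - 1). The product telescopes, and each of the k
  summands is congruent to 1. The congruence for B^k is carried along for the induction.\<close>

lemma geometric_sum_mat:
  fixes B :: "int mat"
  assumes B: "B \<in> carrier_mat n n" and c: "mat_cong n c B (1\<^sub>m n)"
  shows "\<exists>S \<in> carrier_mat n n. S * (B - 1\<^sub>m n) = B ^\<^sub>m k - 1\<^sub>m n \<and>
    mat_cong n c S (int k \<cdot>\<^sub>m 1\<^sub>m n) \<and> mat_cong n c (B ^\<^sub>m k) (1\<^sub>m n)"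
proof (induction k)
  case 0
  show ?case
    by (rule bexI[of _ "0\<^sub>m n n"]) (use B in \<open>auto simp: mat_cong_def\<close>)
next
  case (Suc k)
  then obtain S where S: "S \<in> carrier_mat n n" "S * (B - 1\<^sub>m n) = B ^\<^sub>m k - 1\<^sub>m n"
    "mat_cong n c S (int k \<cdot>\<^sub>m 1\<^sub>m n)" and Bk: "mat_cong n c (B ^\<^sub>m k) (1\<^sub>m n)" by blast
  have Bkc: "B ^\<^sub>m k \<in> carrier_mat n n" using B by simp
  have D: "B - 1\<^sub>m n \<in> carrier_mat n n" by (simp add: minus_carrier_mat)
  have "(S + B ^\<^sub>m k) * (B - 1\<^sub>m n) = (B ^\<^sub>m k - 1\<^sub>m n) + (B ^\<^sub>m k * B - B ^\<^sub>m k)"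
    using add_mult_distrib_mat[OF S(1) Bkc D] S(2) mult_minus_distrib_mat[OF Bkc B one_carrier_mat]
      right_mult_one_mat[OF Bkc] by simp
  also have "\<dots> = B ^\<^sub>m Suc k - 1\<^sub>m n"
    using Bkc B by (intro eq_matI) auto
  finally have 1: "(S + B ^\<^sub>m k) * (B - 1\<^sub>m n) = B ^\<^sub>m Suc k - 1\<^sub>m n" .
  have 2: "mat_cong n c (S + B ^\<^sub>m k) (int (Suc k) \<cdot>\<^sub>m 1\<^sub>m n)"
    unfolding mat_cong_def
  proof (intro allI impI)
    fix i j assume ij: "i < n" "j < n"
    have "[S $$ (i, j) + (B ^\<^sub>m k) $$ (i, j) = (int k \<cdot>\<^sub>m 1\<^sub>m n) $$ (i, j) + 1\<^sub>m n $$ (i, j)] (mod c)"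
      using S(3) Bk ij unfolding mat_cong_def by (intro cong_add) auto
    then show "[(S + B ^\<^sub>m k) $$ (i, j) = (int (Suc k) \<cdot>\<^sub>m 1\<^sub>m n) $$ (i, j)] (mod c)"
      using ij S(1) Bkc B by (simp add: algebra_simps)
  qed
  have 3: "mat_cong n c (B ^\<^sub>m Suc k) (1\<^sub>m n)"
    using mat_cong_mult[OF Bkc _ B _ Bk c] by simp
  show ?case
    by (rule bexI[of _ "S + B ^\<^sub>m k"]) (use 1 2 3 S(1) Bkc in auto)
qed

lemma pow_mat_mult:
  assumes "A \<in> carrier_mat n n"
  shows "(A ^\<^sub>m k) ^\<^sub>m l = A ^\<^sub>m (k * l)"
proof -
  interpret semiring "ring_mat TYPE('a::semiring_1) n ()" by (rule semiring_mat)
  have Ac: "A \<in> carrier (ring_mat TYPE('a) n ())" using assms by (simp add: ring_mat_def)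
  have Ak: "A ^\<^sub>m k \<in> carrier_mat n n" using assms by simp
  show ?thesis
    using nat_pow_pow[OF Ac] pow_mat_ring_pow[OF assms] pow_mat_ring_pow[OF Ak] by metis
qed

(* Minkowski: the congruence subgroup of level 4 is torsion free. With S = 1 + B + ... + B^(m - 1)
   we have S (B - 1) = 0, and S is congruent to m modulo 4. For odd m and for m = 2 this forces
   det S to be nonzero. *)
lemma torsion_cong_one_imp_one:
  fixes B :: "int mat"
  assumes "B \<in> carrier_mat n n" "mat_cong n 4 B (1\<^sub>m n)" "B ^\<^sub>m m = 1\<^sub>m n" "m > 0"
  shows "B = 1\<^sub>m n"
  using assms
proof (induction m arbitrary: B rule: less_induct)
  case (less m)
  note B = less.prems(1) and cong = less.prems(2)
  have D: "B - 1\<^sub>m n \<in> carrier_mat n n" by (simp add: minus_carrier_mat)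
  have B_one: "B = 1\<^sub>m n" if "B - 1\<^sub>m n = 0\<^sub>m n n"
  proof (rule eq_matI)
    fix i j assume "i < dim_row (1\<^sub>m n :: int mat)" "j < dim_col (1\<^sub>m n :: int mat)"
    then show "B $$ (i, j) = 1\<^sub>m n $$ (i, j)"
      using arg_cong[OF that, of "\<lambda>A. A $$ (i, j)"] B by simp
  qed (use B in auto)
  have zero: "1\<^sub>m n - 1\<^sub>m n = (0\<^sub>m n n :: int mat)" by (intro eq_matI) auto
  show ?case
  proof (cases "even m")
    case False
    obtain S where S: "S \<in> carrier_mat n n" "S * (B - 1\<^sub>m n) = 0\<^sub>m n n"
      and Sc: "mat_cong n 4 S (int m \<cdot>\<^sub>m 1\<^sub>m n)"
      using geometric_sum_mat[OF B cong, of m] less.prems(3) zero by auto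
    \<comment> \<open>For odd m the determinant is congruent to the odd number m^n, hence odd and
      nonzero.\<close>
    have "[det S = det (int m \<cdot>\<^sub>m 1\<^sub>m n)] (mod 4)"
      by (rule mat_cong_det[OF S(1) _ Sc]) simp
    then have "[det S = int m ^ n] (mod 4)" by simp
    then have "[det S = int m ^ n] (mod 2)"
      using cong_dvd_modulus[of "det S" "int m ^ n" 4 2] by simp
    moreover have "odd (int m ^ n)" using False by simp
    ultimately have "odd (det S)" by (metis cong_dvd_iff)
    then have "det S \<noteq> 0" by auto
    then show ?thesis using mat_left_cancel_zero[OF S(1) D S(2)] B_one by blast
  next
    case True
    then obtain l where m: "m = 2 * l" by auto
    \<comment> \<open>Since l < m, the induction hypothesis applies to B^2, whose l-th power is 1.
      Only the case of exponent 2 remains, with S = 1 + B.\<close>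
    have "mat_cong n 4 (B ^\<^sub>m 2) (1\<^sub>m n)" using geometric_sum_mat[OF B cong, of 2] by auto
    then have B2: "B ^\<^sub>m 2 = 1\<^sub>m n"
      using less.IH[of l "B ^\<^sub>m 2"] less.prems m pow_mat_mult[OF B, of 2 l] B by simp
    obtain S where S: "S \<in> carrier_mat n n" "S * (B - 1\<^sub>m n) = 0\<^sub>m n n"
      and Sc: "mat_cong n 4 S (2 \<cdot>\<^sub>m 1\<^sub>m n)"
      using geometric_sum_mat[OF B cong, of 2] B2 zero by auto
    \<comment> \<open>S is congruent to 2 modulo 4, so its half T is integral and congruent to 1
      modulo 2, and det T is odd. This halving is the reason for level 4: modulo 2, the involution
      -1 is congruent to 1.\<close>
    define T where "T = map_mat (\<lambda>x. x div 2) S"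
    have T: "T \<in> carrier_mat n n" unfolding T_def using S(1) by simp
    have entry: "S $$ (i, j) = 2 * T $$ (i, j) \<and> [T $$ (i, j) = 1\<^sub>m n $$ (i, j)] (mod 2)"
      if ij: "i < n" "j < n" for i j
    proof -
      have "[S $$ (i, j) = 2 * 1\<^sub>m n $$ (i, j)] (mod 4)"
        using Sc ij unfolding mat_cong_def by auto
      then obtain q where "S $$ (i, j) = 2 * 1\<^sub>m n $$ (i, j) + 4 * q"
        by (metis cong_iff_lin cong_sym)
      then have "T $$ (i, j) = 1\<^sub>m n $$ (i, j) + 2 * q"
        unfolding T_def using ij S(1) by simp
      then show ?thesis
        using \<open>S $$ (i, j) = _\<close> by (simp add: cong_iff_dvd_diff)
    qed
    have ST: "S = 2 \<cdot>\<^sub>m T"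
      using S(1) T entry by (intro eq_matI) auto
    have "mat_cong n 2 T (1\<^sub>m n)" using entry unfolding mat_cong_def by auto
    then have "[det T = det (1\<^sub>m n)] (mod 2)" by (intro mat_cong_det[OF T]) simp
    then have "odd (det T)" by (auto simp: cong_def mod_2_eq_odd)
    then have "det T \<noteq> 0" by auto
    then have "det S \<noteq> 0" unfolding ST by simp
    then show ?thesis using mat_left_cancel_zero[OF S(1) D S(2)] B_one by blast
  qed
qed

section \<open>Finiteness of the set of orders\<close>

lemma finite_carrier_mat_entries:
  assumes "finite F"
  shows "finite {A \<in> carrier_mat n m. \<forall>i<n. \<forall>j<m. A $$ (i, j) \<in> F}"
proof (rule finite_subset)
  show "{A \<in> carrier_mat n m. \<forall>i<n. \<forall>j<m. A $$ (i, j) \<in> F}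
    \<subseteq> mat n m ` PiE ({..<n} \<times> {..<m}) (\<lambda>_. F)"
  proof
    fix A assume A: "A \<in> {A \<in> carrier_mat n m. \<forall>i<n. \<forall>j<m. A $$ (i, j) \<in> F}"
    show "A \<in> mat n m ` PiE ({..<n} \<times> {..<m}) (\<lambda>_. F)"
      by (rule image_eqI[of _ _ "restrict (\<lambda>ij. A $$ ij) ({..<n} \<times> {..<m})"])
        (use A in \<open>auto intro!: eq_matI\<close>)
  qed
  show "finite (mat n m ` PiE ({..<n} \<times> {..<m}) (\<lambda>_. F))"
    using assms by (intro finite_imageI finite_PiE) auto
qed

lemma pow_Sp: "A [^]\<^bsub>Sp g\<^esub> (k::nat) = A ^\<^sub>m k" if "A \<in> carrier (Sp g)"
proof -
  interpret group "Sp g" by (rule group_Sp)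
  have "dim_row A = 2 * g" using that unfolding carrier_Sp_iff by (blast dest: carrier_matD)
  then show ?thesis by (induction k) (simp_all add: mult_Sp one_Sp)
qed

text \<open>Pigeonhole: among the card R + 1 powers A^0, ..., A^(card R), two agree modulo 4. Their
  quotient is a torsion element congruent to 1, hence equal to 1. So the order of A divides a
  positive number that is at most card R.\<close>

lemma finite_Sp_orders: "finite (Sp_orders g)"
proof -
  define n where "n = 2 * g"
  define r where "r = (map_mat (\<lambda>x. x mod 4) :: int mat \<Rightarrow> int mat)"
  define R where "R = {A \<in> carrier_mat n n. \<forall>i<n. \<forall>j<n. A $$ (i, j) \<in> {0..<4::int}}"
  interpret group "Sp g" by (rule group_Sp)
  have finR: "finite R" unfolding R_def by (rule finite_carrier_mat_entries) simp
  have r_cong: "mat_cong n 4 X Y"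
    if "r X = r Y" "X \<in> carrier_mat n n" "Y \<in> carrier_mat n n" for X Y
    unfolding mat_cong_def
  proof (intro allI impI)
    fix i j assume "i < n" "j < n"
    then show "[X $$ (i, j) = Y $$ (i, j)] (mod 4)"
      using arg_cong[OF that(1), of "\<lambda>A. A $$ (i, j)"] carrier_matD[OF that(2)] carrier_matD[OF that(3)]
      unfolding r_def cong_def by (simp only: index_map_mat)
  qed
  have "m \<le> card R" if m: "m \<in> Sp_orders g" for m
  proof -
    obtain A where A: "A \<in> carrier (Sp g)" and ordA: "ord A = m" and m0: "m > 0"
      using m unfolding Sp_orders_def by auto
    have car: "X \<in> carrier_mat n n" if "X \<in> carrier (Sp g)" for X
      using that by (simp add: carrier_Sp_iff n_def)
    define h where "h k = r (A [^]\<^bsub>Sp g\<^esub> k)" for k :: nat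
    have "h k \<in> R" for k
      using car[OF nat_pow_closed[OF A, of k]] unfolding h_def R_def r_def by auto
    then have "h ` {..card R} \<subseteq> R" by auto
    then have "card (h ` {..card R}) \<le> card R" by (rule card_mono[OF finR])
    then have "\<not> inj_on h {..card R}" using card_image[of h "{..card R}"] by auto
    then obtain i j where ij: "i < j" "j \<le> card R" "h i = h j"
      unfolding inj_on_def by (metis atMost_iff nat_neq_iff)
    define B where "B = A [^]\<^bsub>Sp g\<^esub> (j - i)"
    \<comment> \<open>Multiplying the congruence of A^j and A^i by the integral inverse C of A^i
      shows that B is congruent to 1.\<close>
    define C where "C = inv\<^bsub>Sp g\<^esub> (A [^]\<^bsub>Sp g\<^esub> i)"
    have Ai: "A [^]\<^bsub>Sp g\<^esub> i \<in> carrier (Sp g)" and Aj: "A [^]\<^bsub>Sp g\<^esub> j \<in> carrier (Sp g)"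
      and Bc: "B \<in> carrier (Sp g)" and Cc: "C \<in> carrier (Sp g)"
      using A unfolding B_def C_def by auto
    have "A [^]\<^bsub>Sp g\<^esub> j = A [^]\<^bsub>Sp g\<^esub> i \<otimes>\<^bsub>Sp g\<^esub> B"
      unfolding B_def using nat_pow_mult[OF A, of i "j - i"] ij(1) by simp
    then have CB: "C \<otimes>\<^bsub>Sp g\<^esub> A [^]\<^bsub>Sp g\<^esub> j = B"
      unfolding C_def using Ai Bc inv_solve_left' by simp
    have CI: "C \<otimes>\<^bsub>Sp g\<^esub> A [^]\<^bsub>Sp g\<^esub> i = \<one>\<^bsub>Sp g\<^esub>"
      unfolding C_def using Ai by simp
    have "mat_cong n 4 (A [^]\<^bsub>Sp g\<^esub> j) (A [^]\<^bsub>Sp g\<^esub> i)"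
      using r_cong[OF _ car[OF Aj] car[OF Ai]] ij(3) unfolding h_def by simp
    from mat_cong_mult[OF car[OF Cc] car[OF Cc] car[OF Aj] car[OF Ai] mat_cong_refl this]
    have "mat_cong n 4 B (1\<^sub>m n)"
      using CB CI unfolding mult_Sp one_Sp n_def by simp
    moreover have "B [^]\<^bsub>Sp g\<^esub> m = \<one>\<^bsub>Sp g\<^esub>"
      unfolding B_def using A ordA by (simp add: nat_pow_pow pow_eq_id)
    then have "B ^\<^sub>m m = 1\<^sub>m n"
      using pow_Sp[OF Bc] by (simp add: one_Sp n_def)
    ultimately have "B = 1\<^sub>m n"
      using torsion_cong_one_imp_one[OF car[OF Bc]] m0 by blast
    then have "m dvd j - i"
      using pow_eq_id[OF A, of "j - i"] ordA unfolding B_def one_Sp n_def by simp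
    then have "m \<le> j - i" using ij by (intro dvd_imp_le) auto
    then show ?thesis using ij by simp
  qed
  then have "Sp_orders g \<subseteq> {..card R}" unfolding subset_iff atMost_iff by blast
  then show ?thesis by (rule finite_subset[OF _ finite_atMost])
qed

section \<open>Elements of prescribed order\<close>

text \<open>Orthogonality is what makes the block sum of P with itself symplectic. The order is
  encoded by divisibility so that block sums turn directly into least common multiples.\<close>

definition orthogonal_order :: "nat \<Rightarrow> nat \<Rightarrow> bool" where
  "orthogonal_order n m \<longleftrightarrow> (\<exists>P :: int mat. P \<in> carrier_mat n n \<and>
     transpose_mat P * P = 1\<^sub>m n \<and> (\<forall>j. P ^\<^sub>m j = 1\<^sub>m n \<longleftrightarrow> m dvd j))"

lemma orthogonal_order_one: "orthogonal_order n 1"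
proof -
  have "(1\<^sub>m n :: int mat) ^\<^sub>m j = 1\<^sub>m n" for j
    by (induction j) simp_all
  then show ?thesis
    unfolding orthogonal_order_def by (intro exI[of _ "1\<^sub>m n"]) simp
qed

lemma orthogonal_order_cyclic:
  assumes "n > 0"
  shows "orthogonal_order n n"
proof -
  \<comment> \<open>\<open>C k\<close> is the permutation matrix of the shift by k on the integers
    modulo n: column j has its 1 in row (j + k) mod n. It will be the k-th power of
    \<open>C 1\<close>.\<close>
  define C where "C k = (mat n n (\<lambda>(i, j). if i = (j + k) mod n then 1 else 0) :: int mat)" for k
  have C[simp]: "C k \<in> carrier_mat n n" for k by (simp add: C_def)
  have mult: "C k * C 1 = C (Suc k)" for k
  proof (rule eq_matI)
    fix i j assume "i < dim_row (C (Suc k))" "j < dim_col (C (Suc k))"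
    then have ij: "i < n" "j < n" by (simp_all add: C_def)
    have "(C k * C 1) $$ (i, j) = (\<Sum>l\<in>{0..<n}. C k $$ (i, l) * C 1 $$ (l, j))"
      using ij by (simp add: scalar_prod_def C_def)
    also have "\<dots> =
        (\<Sum>l\<in>{0..<n}. if l = (j + 1) mod n then (if i = (l + k) mod n then 1 else 0) else 0)"
      by (rule sum.cong) (use ij in \<open>auto simp: C_def\<close>)
    also have "\<dots> = (if i = ((j + 1) mod n + k) mod n then 1 else 0)"
      using assms by (subst sum.delta) auto
    also have "((j + 1) mod n + k) mod n = (j + Suc k) mod n"
      by (simp add: mod_simps)
    finally show "(C k * C 1) $$ (i, j) = C (Suc k) $$ (i, j)"
      using ij by (simp add: C_def)
  qed (simp_all add: C_def)
  have C0: "C 0 = 1\<^sub>m n"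
    unfolding C_def by (rule eq_matI) auto
  have pow: "C 1 ^\<^sub>m k = C k" for k
  proof (induction k)
    case 0
    then show ?case using C0 carrier_matD[OF C[of 1]] by simp
  next
    case (Suc k)
    then show ?case using mult by simp
  qed
  have orth: "transpose_mat (C 1) * C 1 = 1\<^sub>m n"
  proof (rule eq_matI)
    fix i j assume "i < dim_row (1\<^sub>m n :: int mat)" "j < dim_col (1\<^sub>m n :: int mat)"
    then have ij: "i < n" "j < n" by simp_all
    have "(transpose_mat (C 1) * C 1) $$ (i, j) = (\<Sum>l\<in>{0..<n}. C 1 $$ (l, i) * C 1 $$ (l, j))"
      using ij by (simp add: scalar_prod_def C_def)
    also have "\<dots> =
        (\<Sum>l\<in>{0..<n}. if l = (j + 1) mod n then (if l = (i + 1) mod n then 1 else 0) else 0)"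
      by (rule sum.cong) (use ij in \<open>auto simp: C_def\<close>)
    also have "\<dots> = (if (j + 1) mod n = (i + 1) mod n then 1 else 0)"
      using assms by (subst sum.delta) auto
    also have "(j + 1) mod n = (i + 1) mod n \<longleftrightarrow> i = j"
      using ij by (auto simp: mod_Suc split: if_splits)
    finally show "(transpose_mat (C 1) * C 1) $$ (i, j) = 1\<^sub>m n $$ (i, j)"
      using ij by simp
  qed (simp_all add: C_def)
  have "C k = 1\<^sub>m n \<longleftrightarrow> n dvd k" for k
  proof
    assume "C k = 1\<^sub>m n"
    \<comment> \<open>The corner entry of \<open>C k\<close> is 1 exactly when k mod n = 0.\<close>
    from arg_cong[OF this, of "\<lambda>A. A $$ (0, 0)"] show "n dvd k"
      using assms by (auto simp: C_def split: if_splits)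
  next
    assume "n dvd k"
    then obtain q where "k = n * q" ..
    then show "C k = 1\<^sub>m n"
      unfolding C_def by (intro eq_matI) auto
  qed
  then show ?thesis
    unfolding orthogonal_order_def using orth pow by (intro exI[of _ "C 1"]) simp
qed

section \<open>Block sums and products of distinct primes\<close>

lemma four_block_diag_eq_one_iff:
  assumes "A \<in> carrier_mat a a" "B \<in> carrier_mat b b"
  shows "four_block_mat A (0\<^sub>m a b) (0\<^sub>m b a) B = 1\<^sub>m (a + b) \<longleftrightarrow> A = 1\<^sub>m a \<and> B = 1\<^sub>m b"
proof
  assume eq: "four_block_mat A (0\<^sub>m a b) (0\<^sub>m b a) B = 1\<^sub>m (a + b)"
  show "A = 1\<^sub>m a \<and> B = 1\<^sub>m b"
  proof (intro conjI eq_matI)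
    fix i j assume "i < dim_row (1\<^sub>m a :: 'a mat)" "j < dim_col (1\<^sub>m a :: 'a mat)"
    then show "A $$ (i, j) = 1\<^sub>m a $$ (i, j)"
      using arg_cong[OF eq, of "\<lambda>M. M $$ (i, j)"] assms by auto
  next
    fix i j assume "i < dim_row (1\<^sub>m b :: 'a mat)" "j < dim_col (1\<^sub>m b :: 'a mat)"
    then show "B $$ (i, j) = 1\<^sub>m b $$ (i, j)"
      using arg_cong[OF eq, of "\<lambda>M. M $$ (a + i, a + j)"] assms by auto
  qed (use assms in auto)
qed simp

lemma four_block_diag_orthogonal:
  fixes A B :: "'a :: comm_ring_1 mat"
  assumes A: "A \<in> carrier_mat a a" and B: "B \<in> carrier_mat b b"
    and "transpose_mat A * A = 1\<^sub>m a" "transpose_mat B * B = 1\<^sub>m b"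
  defines "M \<equiv> four_block_mat A (0\<^sub>m a b) (0\<^sub>m b a) B"
  shows "transpose_mat M * M = 1\<^sub>m (a + b)"
proof -
  have AT: "transpose_mat A \<in> carrier_mat a a" and BT: "transpose_mat B \<in> carrier_mat b b"
    using A B by simp_all
  show ?thesis
    unfolding M_def transpose_four_block_mat[OF A zero_carrier_mat zero_carrier_mat B]
      zero_transpose_mat
      mult_four_block_mat[OF AT zero_carrier_mat zero_carrier_mat BT A zero_carrier_mat zero_carrier_mat B]
    using assms by simp
qed

text \<open>Powers of a block sum are taken blockwise, so the j-th power is the identity exactly
  when both k and l divide j.\<close>

lemma orthogonal_order_lcm:
  assumes "orthogonal_order a k" "orthogonal_order b l"
  shows "orthogonal_order (a + b) (lcm k l)"
proof -
  obtain A B :: "int mat" where A: "A \<in> carrier_mat a a" "transpose_mat A * A = 1\<^sub>m a"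
      "\<And>j. A ^\<^sub>m j = 1\<^sub>m a \<longleftrightarrow> k dvd j"
    and B: "B \<in> carrier_mat b b" "transpose_mat B * B = 1\<^sub>m b"
      "\<And>j. B ^\<^sub>m j = 1\<^sub>m b \<longleftrightarrow> l dvd j"
    using assms unfolding orthogonal_order_def by blast
  define M where "M = four_block_mat A (0\<^sub>m a b) (0\<^sub>m b a) B"
  have "M ^\<^sub>m j = 1\<^sub>m (a + b) \<longleftrightarrow> lcm k l dvd j" for j
    unfolding M_def pow_four_block_mat[OF A(1) B(1)]
    using four_block_diag_eq_one_iff[of "A ^\<^sub>m j" a "B ^\<^sub>m j" b] A B by simp
  then show ?thesis
    unfolding orthogonal_order_def using four_block_diag_orthogonal[OF A(1) B(1) A(2) B(2)] A(1) B(1)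
    by (intro exI[of _ M]) (auto simp: M_def)
qed

text \<open>Take the block sum of one p-cycle for each p in T. Coprimality turns the least common
  multiple into a product.\<close>

lemma orthogonal_order_prod_primes:
  assumes "finite T" "\<And>p. p \<in> T \<Longrightarrow> prime p"
  shows "orthogonal_order (\<Sum>T) (\<Prod>T)"
  using assms
proof (induction T)
  case empty
  \<comment> \<open>The empty block sum is the 0 by 0 matrix, of order 1, the empty product.\<close>
  then show ?case using orthogonal_order_one[of 0] by simp
next
  case (insert p T)
  have "coprime p (\<Prod>T)"
    using insert by (intro prod_coprime_right primes_coprime) auto
  then have "lcm p (\<Prod>T) = p * \<Prod>T" by (simp add: lcm_coprime)
  moreover have "orthogonal_order p p"
    using insert.prems prime_gt_0_nat by (intro orthogonal_order_cyclic) auto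
  ultimately show ?case
    using orthogonal_order_lcm[of p p "\<Sum>T" "\<Prod>T"] insert by simp
qed

text \<open>The matrix is padded with an identity block to size g, and its block sum A with itself
  preserves J because the transpose of P is its inverse. A has the same order as P, and m > 1 keeps
  it away from the identity.\<close>

lemma orthogonal_order_imp_Sp_orders:
  assumes "orthogonal_order n m" "n \<le> g" "m > 1"
  shows "m \<in> Sp_orders g"
proof -
  have "orthogonal_order (n + (g - n)) (lcm m 1)"
    by (intro orthogonal_order_lcm assms(1) orthogonal_order_one)
  then have "orthogonal_order g m" using assms(2) by simp
  then obtain P :: "int mat" where P: "P \<in> carrier_mat g g" and PTP: "transpose_mat P * P = 1\<^sub>m g"
    and pow: "\<And>j. P ^\<^sub>m j = 1\<^sub>m g \<longleftrightarrow> m dvd j"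
    unfolding orthogonal_order_def by blast
  have PT: "transpose_mat P \<in> carrier_mat g g" using P by simp
  define A where "A = four_block_mat P (0\<^sub>m g g) (0\<^sub>m g g) P"
  have A: "A \<in> carrier_mat (2 * g) (2 * g)"
    unfolding A_def mult_2 using P by simp
  have I: "- 1\<^sub>m g \<in> carrier_mat g g" for g by simp
  have zero: "- 0\<^sub>m g g = (0\<^sub>m g g :: int mat)" by (intro eq_matI) auto
  have neg: "transpose_mat P * - 1\<^sub>m g = - transpose_mat P" "- transpose_mat P * P = - 1\<^sub>m g"
    using PT P PTP by (simp_all)
  have "transpose_mat A * symp_J g = four_block_mat (0\<^sub>m g g) (transpose_mat P) (- transpose_mat P) (0\<^sub>m g g)"
    unfolding A_def symp_J_def transpose_four_block_mat[OF P zero_carrier_mat zero_carrier_mat P]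
      zero_transpose_mat
      mult_four_block_mat[OF PT zero_carrier_mat zero_carrier_mat PT zero_carrier_mat one_carrier_mat I zero_carrier_mat]
    using PT neg by (simp add: zero)
  also have "\<dots> * A = symp_J g"
    unfolding A_def symp_J_def
      mult_four_block_mat[OF zero_carrier_mat PT uminus_carrier_mat[OF PT] zero_carrier_mat P zero_carrier_mat zero_carrier_mat P]
    using PT P PTP neg by simp
  finally have Ac: "A \<in> carrier (Sp g)" using A by (simp add: carrier_Sp_iff)
  interpret group "Sp g" by (rule group_Sp)
  have "A ^\<^sub>m j = 1\<^sub>m (2 * g) \<longleftrightarrow> m dvd j" for j
    unfolding A_def pow_four_block_mat[OF P P] mult_2
    using four_block_diag_eq_one_iff[of "P ^\<^sub>m j" g "P ^\<^sub>m j" g] P pow by simp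
  then have "ord A dvd j \<longleftrightarrow> m dvd j" for j
    using pow_eq_id[OF Ac, of j] pow_Sp[OF Ac, of j] by (simp add: one_Sp)
  then have "ord A = m" by (meson dvd_antisym dvd_refl)
  moreover have "A \<noteq> \<one>\<^bsub>Sp g\<^esub>" using \<open>ord A = m\<close> assms(3) by auto
  ultimately show ?thesis
    unfolding Sp_orders_def using Ac assms(3) by auto
qed

section \<open>Counting orders by sets of primes\<close>

lemma inj_on_prod_primes:
  "inj_on \<Prod> {T :: nat set. finite T \<and> (\<forall>p\<in>T. prime p)}"
proof (rule inj_onI)
  \<comment> \<open>Unique factorization recovers T from its product.\<close>
  have "prime_factors (\<Prod>T) = T" if "finite T" "\<forall>p\<in>T. prime p" for T :: "nat set"
    using that by (subst prime_factors_prod) (auto simp: prime_prime_factors)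
  then show "S = T" if "S \<in> {T :: nat set. finite T \<and> (\<forall>p\<in>T. prime p)}"
    "T \<in> {T :: nat set. finite T \<and> (\<forall>p\<in>T. prime p)}" "\<Prod>S = \<Prod>T" for S T
    using that by (metis (mono_tags, lifting) mem_Collect_eq)
qed

text \<open>Any k primes up to x have sum at most k * x, hence at most g, so their product is an
  order. Distinct k-subsets give distinct products.\<close>

lemma choose_prime_count_le_num_Sp_orders:
  assumes "k > 0" "k * x \<le> g"
  shows "card {p::nat. prime p \<and> p \<le> x} choose k \<le> num_Sp_orders g"
proof -
  define P where "P = {p::nat. prime p \<and> p \<le> x}"
  define F where "F = {T. T \<subseteq> P \<and> card T = k}"
  have finP: "finite P" unfolding P_def by simp
  have F: "finite T" "\<forall>p\<in>T. prime p" "card T = k" "\<forall>p\<in>T. p \<le> x" if "T \<in> F" for T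
    using that finite_subset[OF _ finP] unfolding F_def by (auto simp: P_def)
  have "\<Prod>T \<in> Sp_orders g" if T: "T \<in> F" for T
  proof (rule orthogonal_order_imp_Sp_orders)
    show "orthogonal_order (\<Sum>T) (\<Prod>T)"
      using F[OF T] by (intro orthogonal_order_prod_primes) auto
    have "\<Sum>T \<le> (\<Sum>p\<in>T. x)" using F[OF T] by (intro sum_mono) auto
    then show "\<Sum>T \<le> g" using F[OF T] assms(2) by simp
    \<comment> \<open>Since k > 0, some prime divides the product, which therefore exceeds
      1.\<close>
    obtain p where p: "p \<in> T" using F[OF T] assms(1) by fastforce
    have "\<Prod>T > 0" using F[OF T] by (auto intro!: prod_pos simp: prime_gt_0_nat)
    moreover have "p dvd \<Prod>T" using F[OF T] p dvd_prodI[of T p "\<lambda>p. p"] by simp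
    moreover have "p > 1" using F[OF T] p prime_gt_1_nat by blast
    ultimately show "\<Prod>T > 1" by (meson dvd_imp_le less_le_trans)
  qed
  then have "card (\<Prod> ` F) \<le> num_Sp_orders g"
    unfolding num_Sp_orders_def by (intro card_mono finite_Sp_orders) auto
  moreover have "card (\<Prod> ` F) = card F"
    by (intro card_image inj_on_subset[OF inj_on_prod_primes]) (use F in auto)
  moreover have "card F = card P choose k" unfolding F_def by (rule n_subsets[OF finP])
  ultimately show ?thesis unfolding P_def by simp
qed

section \<open>The growth estimate\<close>

lemma ln_2_le_7_10: "ln 2 \<le> (7 / 10 :: real)"
proof -
  \<comment> \<open>At 7/10 itself the quadratic Taylor polynomial is only 1.945. Four steps of 7/40
    bring the bound above 2.\<close>
  have "(2::real) \<le> (1 + 7 / 40 + (7 / 40)\<^sup>2 / 2) ^ 4" by (simp add: power_divide field_simps)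
  also have "\<dots> \<le> exp (7 / 40) ^ 4"
    by (intro power_mono exp_lower_Taylor_quadratic) auto
  also have "\<dots> = exp (7 / 10)" by (simp flip: exp_of_nat_mult)
  finally have "ln 2 \<le> ln (exp (7 / 10 :: real))" by (subst ln_le_cancel_iff) auto
  then show ?thesis by simp
qed

lemma exp_1_le_14_5: "exp 1 \<le> (14 / 5 :: real)"
proof -
  have "exp (1::real) = exp (1 / 16) ^ 16" by (simp flip: exp_of_nat_mult)
  \<comment> \<open>The bound 1 + y + y^2 for exp y is sharp enough only for small y, hence the
    sixteen steps.\<close>
  also have "\<dots> \<le> (1 + 1 / 16 + (1 / 16)\<^sup>2) ^ 16"
    by (intro power_mono exp_bound) auto
  also have "\<dots> \<le> 14 / 5" by (simp add: power_divide)
  finally show ?thesis .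
qed

lemma ln_2_ge_2_3: "ln 2 \<ge> (2 / 3 :: real)"
proof -
  have "exp (2::real) = exp 1 ^ 2" by (simp flip: exp_of_nat_mult)
  also have "\<dots> \<le> (14 / 5) ^ 2" using exp_1_le_14_5 by (intro power_mono) auto
  also have "\<dots> \<le> 2 ^ 3" by (simp add: power_divide)
  finally have "2 \<le> ln ((2::real) ^ 3)" by (subst ln_ge_iff) auto
  also have "\<dots> = 3 * ln 2" by (subst ln_realpow) auto
  finally show ?thesis by simp
qed

text \<open>These bounds are all that the main estimate takes from the hypothesis on L. Logarithms
  are compared with log 512 = 9 log 2, since 512 is the power of 2 closest to the threshold
  481.\<close>

lemma quotient_log_ge_64:
  fixes g L :: nat
  assumes "sqrt (real L * ln (real L)) \<ge> 55" "g \<ge> L"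
  shows "ln (real g) \<ge> 5" "real g \<ge> 64 * ln (real g)" "g > 0"
proof -
  have ln512: "ln (512::real) = 9 * ln 2"
    using ln_realpow[of 2 9] by simp
  have LL: "real L * ln (real L) \<ge> 3025"
  proof -
    have "sqrt (55\<^sup>2) \<le> sqrt (real L * ln (real L))" using assms(1) by simp
    then show ?thesis by (simp only: real_sqrt_le_iff) simp
  qed
  \<comment> \<open>For L at most 480 the product is at most 480 * 6.3 = 3024, just below 55^2 =
    3025.\<close>
  have "L \<ge> 481"
  proof (rule ccontr)
    assume "\<not> L \<ge> 481"
    then have L: "real L \<le> 480" by simp
    have "L > 0" using LL by (cases L) auto
    then have "ln (real L) \<le> ln 512" using L by simp
    also have "\<dots> \<le> 63 / 10" using ln512 ln_2_le_7_10 by simp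
    finally have "real L * ln (real L) \<le> 480 * (63 / 10)"
      using L \<open>L > 0\<close> by (intro mult_mono) auto
    then show False using LL by simp
  qed
  then have g: "real g \<ge> 481" using assms(2) by linarith
  then show "g > 0" by simp
  \<comment> \<open>The tangent to the logarithm at 512 gives log g <= 5.3 + g / 512, and 64 times
    the right side is below g once g >= 481.\<close>
  have "ln (real g / 512) \<le> real g / 512 - 1" using g by (intro ln_le_minus_one) simp
  then have "ln (real g) \<le> 9 * ln 2 + real g / 512 - 1"
    using g ln512 by (simp add: ln_div)
  then show "real g \<ge> 64 * ln (real g)" using g ln_2_le_7_10 by linarith
  have "ln (512 / real g) \<le> 512 / real g - 1" using g by (intro ln_le_minus_one) simp
  also have "512 / real g \<le> 512 / 481" using g by (intro divide_left_mono) auto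
  finally have "ln (real g) \<ge> 9 * ln 2 - 31 / 481"
    using g ln512 by (simp add: ln_div)
  then show "ln (real g) \<ge> 5" using ln_2_ge_2_3 by simp
qed

theorem theorem3p7:
  fixes L :: nat
  assumes "sqrt (real L * ln (real L)) \<ge> 55"
  shows "\<forall>g::nat. g \<ge> L \<longrightarrow>
    real (num_Sp_orders g) > exp (1 / 4 * sqrt (real g / ln (real g)))"
proof (intro allI impI)
  fix g :: nat assume "g \<ge> L"
  note g = quotient_log_ge_64[OF assms this]
  define l where "l = ln (real g)"
  define s where "s = sqrt (real g / l)"
  define k where "k = nat \<lceil>s / 4\<rceil>"
  define x where "x = g div k"
  define \<pi> where "\<pi> = card {p::nat. prime p \<and> p \<le> x}"
  have l: "l \<ge> 5" using g by (simp add: l_def)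
  have "real g / l \<ge> 8\<^sup>2" using g l by (simp add: l_def field_simps)
  then have s: "s \<ge> 8" unfolding s_def by (intro real_le_rsqrt)
  have gs: "real g = s\<^sup>2 * l" using g l by (simp add: s_def)
  have k: "s / 4 \<le> real k" "real k \<le> s / 4 + 1" "k > 0"
    using s unfolding k_def by linarith+
  \<comment> \<open>The rounding error 1 is at most s / 8 because s >= 8.\<close>
  have k': "real k \<le> 3 * s / 8" using k s by simp
  have x_le: "real x \<le> 4 * s * l"
  proof -
    have "real x \<le> real g / real k" unfolding x_def by (rule of_nat_div_le_of_nat)
    also have "\<dots> \<le> real g / (s / 4)" using k s by (intro divide_left_mono) auto
    also have "\<dots> = 4 * s * l" using s by (simp add: gs power2_eq_square)
    finally show ?thesis .
  qed
  have x_ge: "real x \<ge> 8 / 3 * s * l - 1"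
  proof -
    have "8 / 3 * s * l = real g / (3 * s / 8)" using s by (simp add: gs power2_eq_square)
    also have "\<dots> \<le> real g / real k" using k k' by (intro divide_left_mono) auto
    also have "\<dots> \<le> real x + 1" unfolding x_def
      using floor_divide_of_nat_eq[of g k, where 'a = real] by linarith
    finally show ?thesis by simp
  qed
  have sl: "s * l \<ge> 40" using mult_mono[of 8 s 5 l] s l by simp
  then have x1: "real x > 1" using x_ge by simp
  \<comment> \<open>The factor 3 is the least integer above e, so that 3^k exceeds e^k in the
    end.\<close>
  have "3 * k \<le> \<pi>"
  proof (rule ccontr)
    assume "\<not> 3 * k \<le> \<pi>"
    then have \<pi>: "real \<pi> \<le> 3 * real k" by simp
    \<comment> \<open>Here log s = (l - log l) / 2, so log (4 s l) = log 4 + l / 2 + (log l) / 2,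
      and log l <= l - 1.\<close>
    have ln_x: "ln (real x) \<le> ln 4 + l - 1 / 2"
    proof -
      have "ln (real x) \<le> ln (4 * s * l)" using x_le x1 sl by (subst ln_le_cancel_iff) (auto simp: mult_ac)
      also have "\<dots> = ln 4 + ln s + ln l" using s l by (simp add: ln_mult)
      finally have "ln (real x) \<le> ln 4 + ln s + ln l" .
      moreover have "ln s = (l - ln l) / 2"
        unfolding s_def using g l by (simp add: ln_sqrt ln_div l_def)
      moreover have "ln l \<le> l - 1" using l by (intro ln_le_minus_one) simp
      ultimately show ?thesis by (simp add: field_simps)
    qed
    have x0: "x > 0" using x1 by simp
    \<comment> \<open>Taking logarithms, (x - 1) log 2 is at most \<pi> log x. With \<pi> <= 3 k <=
      9 s / 8 the right side becomes too small.\<close>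
    have "(2::real) ^ (x - 1) \<le> real x ^ \<pi>"
      using two_power_le_power_prime_count[OF x0] unfolding \<pi>_def
      by (metis of_nat_le_iff of_nat_numeral of_nat_power)
    then have "ln ((2::real) ^ (x - 1)) \<le> ln (real x ^ \<pi>)"
      using x1 by (subst ln_le_cancel_iff) auto
    then have "(real x - 1) * ln 2 \<le> real \<pi> * ln (real x)"
      using x1 by (simp add: ln_realpow of_nat_diff)
    moreover have "real \<pi> * ln (real x) \<le> (9 * s / 8) * (ln 4 + l - 1 / 2)"
      using \<pi> k' ln_x x1 s by (intro mult_mono) auto
    moreover have "(8 / 3 * s * l - 2) * (2 / 3) \<le> (real x - 1) * ln 2"
      using x_ge x1 sl ln_2_ge_2_3 by (intro mult_mono) auto
    moreover have "ln (4::real) \<le> 7 / 5"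
      using ln_realpow[of 2 2] ln_2_le_7_10 by simp
    then have "(9 * s / 8) * (ln 4 + l - 1 / 2) \<le> (9 * s / 8) * (9 / 10 + l)"
      using s by (intro mult_left_mono) auto
    \<comment> \<open>The coefficients 16/9 and 9/8 of s l differ by 47/72. As l >= 5, this gains
      more than 3 s, which outweighs 81/80 s + 4/3 for s >= 8.\<close>
    moreover have "(9 * s / 8) * (9 / 10 + l) < (8 / 3 * s * l - 2) * (2 / 3)"
    proof -
      have "(9 * s / 8) * (9 / 10 + l) = 81 / 80 * s + 9 / 8 * (s * l)"
        "(8 / 3 * s * l - 2) * (2 / 3) = 16 / 9 * (s * l) - 4 / 3"
        by (simp_all add: algebra_simps)
      then show ?thesis using mult_left_mono[OF l, of s] s by linarith
    qed
    ultimately show False by linarith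
  qed
  have "exp (1 / 4 * s) \<le> exp (real k)" using k by simp
  also have "\<dots> = exp 1 ^ k" by (simp flip: exp_of_nat_mult)
  also have "\<dots> < 3 ^ k" using exp_1_le_14_5 k by (intro power_strict_mono) auto
  also have "\<dots> \<le> (real \<pi> / real k) ^ k"
    using \<open>3 * k \<le> \<pi>\<close> k by (intro power_mono) (auto simp: field_simps simp flip: of_nat_mult)
  also have "\<dots> \<le> real (\<pi> choose k)"
    using \<open>3 * k \<le> \<pi>\<close> by (intro binomial_ge_n_over_k_pow_k) simp
  also have "\<dots> \<le> real (num_Sp_orders g)"
    unfolding \<pi>_def using k by (simp add: choose_prime_count_le_num_Sp_orders x_def)
  finally show "real (num_Sp_orders g) > exp (1 / 4 * sqrt (real g / ln (real g)))"
    unfolding s_def l_def by simp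
qed

end
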